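(* Let $M$ be a matroid on a ground set $E$ and let $<$ be a linear order on $E$. There is a simplicial complex $B_<(M)$ on the $2|E|$-element set $\{x_e, y_e : e \in E\}$, called the external activity complex, such that: 1. The minimal non-faces of $B_<(M)$ are the sets $x_{\min C}\, y_{C-\min C}$ for each circuit $C$ of $M$. 2. The facets of $B_<(M)$ are the sets $x_{B \cup EP(B)}\, y_{B \cup EA(B)}$ for each basis $B$ of $M$.
   Context: Notation: for $A,B\subseteq E$, $x_Ay_B:=\{x_a:a\in A\}\cup\{y_b:b\in B\}$, a subset of $\{x_e,y_e:e\in E\}$. $\min C$ is the smallest element of $C$ with respect to $<$ (or the corresponding singleton). Activities: for a basis $B$ of $M$ and $e\in E\setminus B$, let $C(B,e)$ be the fundamental circuit, i.e. the unique circuit contained in $B\cup e$. The element $e$ is externally active with respect to $B$ if $e$ is the smallest element of $C(B,e)$, and externally passive otherwise. $EA(B)=EA_<(B)$ and $EP(B)=EP_<(B)$ are the sets of externally active and externally passive elements of $E\setminus B$. A simplicial complex on a set $V$ is a family of subsets of $V$ closed under taking subsets (single elements of $V$ need not be faces). *)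

theory Defs
  imports Main
begin

locale matroid =
  fixes E :: "'a set" and indep :: "'a set \<Rightarrow> bool"
  assumes finite_ground: "finite E"
    and indep_subset_ground: "indep I \<Longrightarrow> I \<subseteq> E"
    and indep_empty: "indep {}"
    and indep_hereditary: "indep I \<Longrightarrow> J \<subseteq> I \<Longrightarrow> indep J"
    and indep_augment: "indep I \<Longrightarrow> indep J \<Longrightarrow> card I < card J \<Longrightarrow>
      \<exists>e\<in>J - I. indep (insert e I)"

definition basis :: "'a set \<Rightarrow> ('a set \<Rightarrow> bool) \<Rightarrow> 'a set \<Rightarrow> bool" where
  "basis E indep B \<longleftrightarrow> B \<subseteq> E \<and> indep B \<and> (\<forall>e\<in>E - B. \<not> indep (insert e B))"

definition circuit :: "'a set \<Rightarrow> ('a set \<Rightarrow> bool) \<Rightarrow> 'a set \<Rightarrow> bool" where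
  "circuit E indep C \<longleftrightarrow> C \<subseteq> E \<and> \<not> indep C \<and> (\<forall>D. D \<subset> C \<longrightarrow> indep D)"

definition fundamental_circuit ::
  "'a set \<Rightarrow> ('a set \<Rightarrow> bool) \<Rightarrow> 'a set \<Rightarrow> 'a \<Rightarrow> 'a set" where
  "fundamental_circuit E indep B e = (THE C. circuit E indep C \<and> C \<subseteq> insert e B)"

text \<open>
  As in \<^const>\<open>linear_order_on\<close>, the linear order on the ground set is given by its reflexive
  relation \<open>r\<close>: a pair \<open>(a, b) \<in> r\<close> stands for \<open>a \<le> b\<close>.
\<close>

definition least_elt :: "'a rel \<Rightarrow> 'a set \<Rightarrow> 'a" where
  "least_elt r C = (THE m. m \<in> C \<and> (\<forall>c\<in>C. (m, c) \<in> r))"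

definition EA :: "'a set \<Rightarrow> ('a set \<Rightarrow> bool) \<Rightarrow> 'a rel \<Rightarrow> 'a set \<Rightarrow> 'a set" where
  "EA E indep r B = {e \<in> E - B. e = least_elt r (fundamental_circuit E indep B e)}"

definition EP :: "'a set \<Rightarrow> ('a set \<Rightarrow> bool) \<Rightarrow> 'a rel \<Rightarrow> 'a set \<Rightarrow> 'a set" where
  "EP E indep r B = {e \<in> E - B. e \<noteq> least_elt r (fundamental_circuit E indep B e)}"

text \<open>Singletons of elements of \<open>V\<close> are not required to be faces.\<close>

definition simplicial_complex :: "'v set \<Rightarrow> 'v set set \<Rightarrow> bool" where
  "simplicial_complex V \<Delta> \<longleftrightarrow> \<Delta> \<subseteq> Pow V \<and> (\<forall>F\<in>\<Delta>. \<forall>G. G \<subseteq> F \<longrightarrow> G \<in> \<Delta>)"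

definition facets :: "'v set set \<Rightarrow> 'v set set" where
  "facets \<Delta> = {F \<in> \<Delta>. \<forall>G\<in>\<Delta>. F \<subseteq> G \<longrightarrow> F = G}"

definition minimal_nonfaces :: "'v set \<Rightarrow> 'v set set \<Rightarrow> 'v set set" where
  "minimal_nonfaces V \<Delta> = {N. N \<subseteq> V \<and> N \<notin> \<Delta> \<and> (\<forall>G. G \<subset> N \<longrightarrow> G \<in> \<Delta>)}"

text \<open>
  The vertices \<open>x\<^sub>e\<close> and \<open>y\<^sub>e\<close> are \<open>Inl e\<close> and \<open>Inr e\<close>, so that the set written
  \<open>x\<^sub>A y\<^sub>B\<close> is the disjoint union \<open>A <+> B\<close>.
\<close>

abbreviation xy_set :: "'a set \<Rightarrow> 'a set \<Rightarrow> ('a + 'a) set" where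
  "xy_set A B \<equiv> A <+> B"

end

theory Submission
  imports Defs
begin

text \<open>
  The complex is forced: its faces are the sets \<open>x\<^sub>X y\<^sub>Y\<close> that contain no
  \<open>x\<^bsub>min C\<^esub> y\<^bsub>C - min C\<^esub>\<close>. These forbidden sets form an antichain because circuits do, so they
  are the minimal non-faces, and the content of the theorem is the description of the facets.
  Write \<open>F\<^sub>B\<close> for the proposed facet of a basis \<open>B\<close>. The link between the two descriptions is
  that \<open>e \<notin> B\<close> is externally active exactly when it depends on the elements of \<open>B\<close> above it
  (\<open>fundamental_circuit_least_iff\<close>).

  Every \<open>F\<^sub>B\<close> is a face. If it contained the forbidden set of a circuit \<open>C\<close> with minimum \<open>m\<close>, each
  element of \<open>C - m\<close> would lie in \<open>B\<close> or be active, hence be spanned by the part of \<open>B\<close> above \<open>m\<close>.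
  Then so would be \<open>m\<close> (\<open>dependent_transfer\<close>), which is impossible if \<open>m \<in> B\<close> and makes \<open>m\<close> active
  otherwise.

  Every face \<open>x\<^sub>X y\<^sub>Y\<close> lies in some \<open>F\<^sub>B\<close>. Let \<open>B\<close> be the greedy basis obtained by running
  through \<open>Y\<close> downwards and then through \<open>E - Y\<close> upwards. A rejected element depends on the
  accepted elements before it. For an element of \<open>Y\<close> these are all larger, so it is active. If a
  rejected \<open>e \<in> X\<close> were active, its fundamental circuit would consist, apart from \<open>e\<close>, of elements
  that are both larger than \<open>e\<close> and earlier than \<open>e\<close>, hence of elements of \<open>Y\<close>, and the face would
  contain a forbidden set.

  Finally, \<open>B\<close> is recovered from \<open>F\<^sub>B\<close> as the set of \<open>e\<close> for which both \<open>x\<^sub>e\<close> and \<open>y\<^sub>e\<close> occur,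
  so \<open>F\<^sub>B \<subseteq> F\<^sub>B\<^sub>'\<close> implies \<open>B \<subseteq> B'\<close> and thus \<open>B = B'\<close>: the sets \<open>F\<^sub>B\<close> are exactly the maximal
  faces.
\<close>

section \<open>Dependence and fundamental circuits\<close>

context matroid
begin

lemma finite_subset_ground: "A \<subseteq> E \<Longrightarrow> finite A"
  using finite_ground finite_subset by blast

lemma indep_extend:
  assumes "indep I" "indep J"
  obtains K where "I \<subseteq> K" "K \<subseteq> I \<union> J" "indep K" "card J \<le> card K"
proof -
  have "\<exists>K. I \<subseteq> K \<and> K \<subseteq> I \<union> J \<and> indep K \<and> card J \<le> card K" using assms(1)
  proof (induction "card J - card I" arbitrary: I)
    case 0
    then show ?case by auto
  next
    case (Suc n)
    then have "card I < card J" by linarith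
    then obtain e where e: "e \<in> J - I" "indep (insert e I)"
      using indep_augment[OF Suc.prems assms(2)] by blast
    have "finite I" using Suc.prems indep_subset_ground finite_subset_ground by blast
    then have "n = card J - card (insert e I)" using Suc.hyps(2) e(1) by simp
    from Suc.hyps(1)[OF this e(2)] show ?case using e(1) by blast
  qed
  then show ?thesis using that by blast
qed

text \<open>
  Transitivity of the closure operator, in terms of independence alone: if \<open>S\<close> spans \<open>m\<close> and \<open>T\<close>
  spans \<open>S\<close>, then \<open>T\<close> spans \<open>m\<close>. Otherwise \<open>S\<close> could be enlarged from \<open>insert m T\<close> to an independent
  set with more elements than \<open>T\<close>, and as it avoids \<open>m\<close>, \<open>T\<close> could be augmented by an element of \<open>S\<close>.
\<close>

lemma dependent_transfer:
  assumes S: "indep S" "\<not> indep (insert m S)"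
    and T: "indep T" "m \<notin> T"
    and spans: "\<And>e. e \<in> S - T \<Longrightarrow> \<not> indep (insert e T)"
  shows "\<not> indep (insert m T)"
proof
  assume "indep (insert m T)"
  with S(1) obtain K where K: "S \<subseteq> K" "K \<subseteq> S \<union> insert m T" "indep K"
      "card (insert m T) \<le> card K"
    by (rule indep_extend)
  have "m \<notin> K" using K(1,3) S(2) indep_hereditary by blast
  have "finite T" using T(1) indep_subset_ground finite_subset_ground by blast
  then have "card T < card K" using K(4) T(2) by simp
  then obtain e where "e \<in> K - T" "indep (insert e T)"
    using indep_augment[OF T(1) K(3)] by blast
  then show False using spans K(2) \<open>m \<notin> K\<close> by blast
qed

lemma dependent_contains_circuit:
  assumes "D \<subseteq> E" "\<not> indep D"
  obtains C where "circuit E indep C" "C \<subseteq> D"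
proof -
  have "finite D" using assms(1) finite_subset_ground by blast
  then have "\<exists>C. circuit E indep C \<and> C \<subseteq> D" using assms
  proof (induction D rule: finite_psubset_induct)
    case (psubset D)
    show ?case
    proof (cases "\<forall>D'. D' \<subset> D \<longrightarrow> indep D'")
      case True
      then show ?thesis using psubset.prems unfolding circuit_def by blast
    next
      case False
      then obtain D' where "D' \<subset> D" "\<not> indep D'" by blast
      then show ?thesis using psubset.IH[of D'] psubset.prems by blast
    qed
  qed
  then show ?thesis using that by blast
qed

text \<open>
  If \<open>c \<in> C - C'\<close>, then \<open>C - {c}\<close> extends to an independent subset of \<open>insert e B\<close> of size
  \<open>card B\<close>. It omits \<open>c\<close>, so it is all of \<open>insert e B - {c}\<close>, which is
  impossible because it contains \<open>C'\<close>.
\<close>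

lemma circuit_in_insert_subset:
  assumes B: "indep B"
    and C: "circuit E indep C" "C \<subseteq> insert e B"
    and C': "circuit E indep C'" "C' \<subseteq> insert e B"
  shows "C \<subseteq> C'"
proof
  fix c assume c: "c \<in> C"
  show "c \<in> C'"
  proof (rule ccontr)
    assume "c \<notin> C'"
    have "\<not> C' \<subseteq> B"
      using C'(1) indep_hereditary[OF B, of C'] unfolding circuit_def by blast
    then have "e \<in> C'" using C'(2) by blast
    then have "c \<noteq> e" using \<open>c \<notin> C'\<close> by blast
    then have "c \<in> B" using c C(2) by blast
    have "indep (C - {c})"
      using C(1) c unfolding circuit_def by (metis Diff_subset Diff_iff insertI1 psubsetI)
    then obtain K where K: "C - {c} \<subseteq> K" "K \<subseteq> (C - {c}) \<union> B" "indep K" "card B \<le> card K"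
      using B by (rule indep_extend)
    have "c \<notin> K"
    proof
      assume "c \<in> K"
      then have "C \<subseteq> K" using K(1) by blast
      then show False using K(3) C(1) indep_hereditary unfolding circuit_def by blast
    qed
    then have sub: "K \<subseteq> insert e (B - {c})" using K(2) C(2) by blast
    have "finite B" using B indep_subset_ground finite_subset_ground by blast
    then have "card (insert e (B - {c})) \<le> Suc (card (B - {c}))"
      by (simp add: card_insert_if)
    then have "card (insert e (B - {c})) \<le> card B"
      using card_Suc_Diff1[OF \<open>finite B\<close> \<open>c \<in> B\<close>] by simp
    then have "K = insert e (B - {c})"
      using sub K(4) \<open>finite B\<close> by (intro card_seteq) auto
    then have "C' \<subseteq> K" using C'(2) \<open>c \<notin> C'\<close> by blast
    then show False using K(3) C'(1) indep_hereditary unfolding circuit_def by blast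
  qed
qed

lemma fundamental_circuit_unique:
  assumes "indep B" "circuit E indep C" "C \<subseteq> insert e B"
  shows "fundamental_circuit E indep B e = C"
  unfolding fundamental_circuit_def
proof (rule the_equality)
  show "C' = C" if "circuit E indep C' \<and> C' \<subseteq> insert e B" for C'
    using circuit_in_insert_subset[OF assms(1)] assms(2,3) that by blast
qed (use assms in blast)

lemma basis_insert_dependent:
  "basis E indep B \<Longrightarrow> e \<in> E - B \<Longrightarrow> \<not> indep (insert e B)"
  unfolding basis_def by blast

lemma fundamental_circuit_subset:
  assumes "basis E indep B" "e \<in> E - B" "A \<subseteq> B" "\<not> indep (insert e A)"
  shows "circuit E indep (fundamental_circuit E indep B e)"
    and "e \<in> fundamental_circuit E indep B e"
    and "fundamental_circuit E indep B e \<subseteq> insert e A"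
proof -
  have B: "indep B" "B \<subseteq> E" using assms(1) unfolding basis_def by auto
  obtain C where C: "circuit E indep C" "C \<subseteq> insert e A"
    using dependent_contains_circuit[of "insert e A"] assms(2-4) B(2) by blast
  have eq: "fundamental_circuit E indep B e = C"
    using fundamental_circuit_unique[OF B(1) C(1)] C(2) assms(3) by blast
  have "e \<in> C"
    using C assms(3) B(1) indep_hereditary[of B C] unfolding circuit_def by blast
  then show "circuit E indep (fundamental_circuit E indep B e)"
    and "e \<in> fundamental_circuit E indep B e"
    and "fundamental_circuit E indep B e \<subseteq> insert e A"
    using C unfolding eq by auto
qed

text \<open>
  The greedy algorithm, run in the order of increasing \<open>g\<close>. Later acceptances do not change the set
  \<open>{b \<in> B. g b < g e}\<close> that caused the rejection of \<open>e\<close>.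
\<close>

lemma greedy_basis:
  fixes g :: "'a \<Rightarrow> 'b::linorder"
  assumes "inj_on g E"
  obtains B where "basis E indep B"
    "\<And>e. e \<in> E - B \<Longrightarrow> \<not> indep (insert e {b \<in> B. g b < g e})"
proof -
  have "S \<subseteq> E \<Longrightarrow> \<exists>B \<subseteq> S. indep B \<and> (\<forall>e \<in> S - B. \<not> indep (insert e {b \<in> B. g b < g e}))"
    if "finite S" for S
    using that
  proof (induction S rule: finite_ranking_induct[where f = g])
    case empty
    then show ?case using indep_empty by auto
  next
    case (insert x S)
    then obtain B where B: "B \<subseteq> S" "indep B"
      "\<forall>e \<in> S - B. \<not> indep (insert e {b \<in> B. g b < g e})" by auto
    show ?case
    proof (cases "x \<in> S")
      case True
      then show ?thesis using B by (metis insert_absorb)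
    next
      case False
      have less: "g b < g x" if "b \<in> S" for b
      proof -
        have "g b \<noteq> g x"
          using inj_onD[OF assms] that False insert.prems by blast
        then show ?thesis using insert.hyps(2)[OF that] by simp
      qed
      show ?thesis
      proof (cases "indep (insert x B)")
        case True
        have "{b \<in> insert x B. g b < g e} = {b \<in> B. g b < g e}" if "e \<in> S" for e
          using less[OF that] by auto
        then have "\<forall>e \<in> insert x S - insert x B.
            \<not> indep (insert e {b \<in> insert x B. g b < g e})"
          using B(3) by auto
        then show ?thesis using True B(1) by (intro exI[of _ "insert x B"]) auto
      next
        case False
        have "{b \<in> B. g b < g x} = B" using less B(1) by auto
        then have "\<forall>e \<in> insert x S - B. \<not> indep (insert e {b \<in> B. g b < g e})"
          using B(3) False by auto
        then show ?thesis using B by (intro exI[of _ B]) auto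
      qed
    qed
  qed
  from this[OF finite_ground order_refl] obtain B where B: "B \<subseteq> E" "indep B"
    "\<forall>e \<in> E - B. \<not> indep (insert e {b \<in> B. g b < g e})" by blast
  have "\<not> indep (insert e B)" if "e \<in> E - B" for e
    using B(3) that indep_hereditary[of "insert e B" "insert e {b \<in> B. g b < g e}"] by blast
  then have "basis E indep B" using B unfolding basis_def by blast
  then show ?thesis using that B(3) by blast
qed

lemma basis_subset_eq:
  assumes "basis E indep B" "basis E indep B'" "B \<subseteq> B'"
  shows "B = B'"
proof (rule ccontr)
  assume "B \<noteq> B'"
  then obtain e where "e \<in> B'" "e \<notin> B" using assms(3) by blast
  moreover have "indep (insert e B)"
    using assms(2,3) \<open>e \<in> B'\<close> indep_hereditary[of B' "insert e B"] unfolding basis_def by blast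
  ultimately show False using assms(1,2) unfolding basis_def by blast
qed

end

section \<open>Activity with respect to a linear order\<close>

locale ordered_matroid = matroid E indep
  for E :: "'a set" and indep +
  fixes r :: "'a rel"
  assumes lin: "linear_order_on E r"
begin

lemma r_refl: "a \<in> E \<Longrightarrow> (a, a) \<in> r"
  using lin
  by (auto simp: linear_order_on_def partial_order_on_def preorder_on_def refl_on_def)

lemma r_trans: "(a, b) \<in> r \<Longrightarrow> (b, c) \<in> r \<Longrightarrow> (a, c) \<in> r"
  using lin
  by (auto simp: linear_order_on_def partial_order_on_def preorder_on_def dest: transD)

lemma r_antisym: "(a, b) \<in> r \<Longrightarrow> (b, a) \<in> r \<Longrightarrow> a = b"
  using lin by (auto simp: linear_order_on_def partial_order_on_def dest: antisymD)

lemma r_total: "a \<in> E \<Longrightarrow> b \<in> E \<Longrightarrow> (a, b) \<in> r \<or> (b, a) \<in> r"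
  using lin r_refl by (cases "a = b") (auto simp: linear_order_on_def total_on_def)

definition rank :: "'a \<Rightarrow> nat" where
  "rank e = card {x \<in> E. (x, e) \<in> r}"

lemma rank_le_iff:
  assumes "a \<in> E" "b \<in> E"
  shows "rank a \<le> rank b \<longleftrightarrow> (a, b) \<in> r"
proof
  assume "(a, b) \<in> r"
  then show "rank a \<le> rank b"
    unfolding rank_def using finite_ground r_trans by (intro card_mono) auto
next
  assume le: "rank a \<le> rank b"
  show "(a, b) \<in> r"
  proof (rule ccontr)
    assume nab: "(a, b) \<notin> r"
    then have "(b, a) \<in> r" using r_total assms by blast
    then have "{x \<in> E. (x, b) \<in> r} \<subset> {x \<in> E. (x, a) \<in> r}"
      using nab assms r_trans r_refl by blast
    then have "rank b < rank a"
      unfolding rank_def using finite_ground by (intro psubset_card_mono) auto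
    then show False using le by simp
  qed
qed

lemma rank_inj: "inj_on rank E"
  using rank_le_iff r_antisym by (intro inj_onI) (metis order_refl)

lemma rank_pos: "e \<in> E \<Longrightarrow> 0 < rank e"
  unfolding rank_def using finite_ground r_refl by (auto simp: card_gt_0_iff)

lemma least_elt_eqI:
  assumes "m \<in> C" "\<And>c. c \<in> C \<Longrightarrow> (m, c) \<in> r"
  shows "least_elt r C = m"
  unfolding least_elt_def using assms r_antisym by (intro the_equality) blast+

lemma least_elt_circuit:
  assumes "circuit E indep C"
  shows "least_elt r C \<in> C" and "c \<in> C \<Longrightarrow> (least_elt r C, c) \<in> r"
proof -
  have sub: "C \<subseteq> E" and "C \<noteq> {}"
    using assms indep_empty unfolding circuit_def by auto
  then have "finite C" using finite_subset_ground by blast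
  then obtain m where m: "m \<in> C" "\<And>c. c \<in> C \<Longrightarrow> rank m \<le> rank c"
    using \<open>C \<noteq> {}\<close> arg_min_if_finite[of C rank] by (metis linorder_not_le)
  then have mr: "(m, c) \<in> r" if "c \<in> C" for c
    using rank_le_iff[of m c] sub that by blast
  with m(1) have "least_elt r C = m" by (intro least_elt_eqI) auto
  then show "least_elt r C \<in> C" and "c \<in> C \<Longrightarrow> (least_elt r C, c) \<in> r"
    using m(1) mr by auto
qed

text \<open>
  The fundamental circuit of \<open>e\<close> is the only possible circuit in \<open>insert e A\<close> for \<open>A \<subseteq> B\<close>, so \<open>e\<close>
  is its minimum exactly when it is already formed with the elements of \<open>B\<close> above \<open>e\<close>.
\<close>

lemma fundamental_circuit_least_iff:
  assumes B: "basis E indep B" and e: "e \<in> E - B"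
  shows "e = least_elt r (fundamental_circuit E indep B e) \<longleftrightarrow>
    \<not> indep (insert e {b \<in> B. (e, b) \<in> r})"
    (is "?l \<longleftrightarrow> _")
proof
  let ?C = "fundamental_circuit E indep B e"
  note C = fundamental_circuit_subset[OF B e order_refl basis_insert_dependent[OF B e]]
  assume ?l
  then have "\<And>c. c \<in> ?C \<Longrightarrow> (e, c) \<in> r" using least_elt_circuit(2)[OF C(1)] by simp
  then have "?C \<subseteq> insert e {b \<in> B. (e, b) \<in> r}" using C(3) by blast
  then show "\<not> indep (insert e {b \<in> B. (e, b) \<in> r})"
    using C(1) indep_hereditary unfolding circuit_def by blast
next
  assume dep: "\<not> indep (insert e {b \<in> B. (e, b) \<in> r})"
  have "{b \<in> B. (e, b) \<in> r} \<subseteq> B" by blast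
  note C = fundamental_circuit_subset[OF B e this dep]
  show ?l using C(2,3) e r_refl by (intro least_elt_eqI[symmetric]) auto
qed

lemma mem_EA_iff:
  "basis E indep B \<Longrightarrow>
    e \<in> EA E indep r B \<longleftrightarrow> e \<in> E - B \<and> \<not> indep (insert e {b \<in> B. (e, b) \<in> r})"
  using fundamental_circuit_least_iff unfolding EA_def by blast

lemma mem_EP_iff: "e \<in> EP E indep r B \<longleftrightarrow> e \<in> E - B \<and> e \<notin> EA E indep r B"
  unfolding EA_def EP_def by blast

section \<open>The external activity complex\<close>

definition circuit_nonface :: "'a set \<Rightarrow> ('a + 'a) set" where
  "circuit_nonface C = xy_set {least_elt r C} (C - {least_elt r C})"

definition basis_face :: "'a set \<Rightarrow> ('a + 'a) set" where
  "basis_face B = xy_set (B \<union> EP E indep r B) (B \<union> EA E indep r B)"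

definition activity_complex :: "('a + 'a) set set" where
  "activity_complex =
    {F. F \<subseteq> xy_set E E \<and> (\<forall>C. circuit E indep C \<longrightarrow> \<not> circuit_nonface C \<subseteq> F)}"

lemma circuit_nonface_subset_iff:
  "circuit_nonface C \<subseteq> F \<longleftrightarrow>
    Inl (least_elt r C) \<in> F \<and> (\<forall>c \<in> C - {least_elt r C}. Inr c \<in> F)"
  unfolding circuit_nonface_def by auto

lemma simplicial_activity_complex: "simplicial_complex (xy_set E E) activity_complex"
  unfolding simplicial_complex_def activity_complex_def by blast

lemma circuit_nonface_antichain:
  assumes C: "circuit E indep C" "circuit E indep C'"
    and sub: "circuit_nonface C \<subseteq> circuit_nonface C'"
  shows "C = C'"
proof -
  have "least_elt r C = least_elt r C'" "C - {least_elt r C} \<subseteq> C' - {least_elt r C'}"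
    using sub unfolding circuit_nonface_def by auto
  then have "C \<subseteq> C'" using least_elt_circuit(1)[OF C(2)] by auto
  then show ?thesis using C unfolding circuit_def by blast
qed

lemma minimal_nonfaces_activity_complex:
  "minimal_nonfaces (xy_set E E) activity_complex = {circuit_nonface C | C. circuit E indep C}"
proof (intro set_eqI iffI)
  fix N assume "N \<in> minimal_nonfaces (xy_set E E) activity_complex"
  then have N: "N \<subseteq> xy_set E E" "N \<notin> activity_complex"
    "\<And>G. G \<subset> N \<Longrightarrow> G \<in> activity_complex"
    unfolding minimal_nonfaces_def by auto
  obtain C where C: "circuit E indep C" "circuit_nonface C \<subseteq> N"
    using N(1,2) unfolding activity_complex_def by blast
  have "circuit_nonface C \<notin> activity_complex"
    using C(1) unfolding activity_complex_def by blast
  then have "N = circuit_nonface C" using N(3) C(2) by blast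
  then show "N \<in> {circuit_nonface C | C. circuit E indep C}" using C(1) by blast
next
  fix N assume "N \<in> {circuit_nonface C | C. circuit E indep C}"
  then obtain C where C: "circuit E indep C" "N = circuit_nonface C" by blast
  have V: "N \<subseteq> xy_set E E"
    using C(1) least_elt_circuit(1)[OF C(1)]
    unfolding C(2) circuit_nonface_def circuit_def by auto
  have "N \<notin> activity_complex" using C unfolding activity_complex_def by blast
  moreover have "G \<in> activity_complex" if "G \<subset> N" for G
  proof -
    have "\<not> circuit_nonface C' \<subseteq> G" if C': "circuit E indep C'" for C'
    proof
      assume "circuit_nonface C' \<subseteq> G"
      then have "circuit_nonface C' \<subset> circuit_nonface C" using \<open>G \<subset> N\<close> C(2) by blast
      then show False using circuit_nonface_antichain[OF C' C(1)] by blast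
    qed
    then show ?thesis using V that unfolding activity_complex_def by blast
  qed
  ultimately show "N \<in> minimal_nonfaces (xy_set E E) activity_complex"
    using V unfolding minimal_nonfaces_def by blast
qed

text \<open>
  The elements of \<open>C\<close> other than its minimum \<open>m\<close> are spanned by the elements of \<open>B\<close> above \<open>m\<close>,
  directly or by activity, so \<open>m\<close> is spanned by them as well.
\<close>

lemma basis_face_mem:
  assumes B: "basis E indep B"
  shows "basis_face B \<in> activity_complex"
proof -
  have BE: "B \<subseteq> E" "indep B" using B unfolding basis_def by auto
  have "\<not> circuit_nonface C \<subseteq> basis_face B" if C: "circuit E indep C" for C
  proof
    assume sub: "circuit_nonface C \<subseteq> basis_face B"
    define m where "m = least_elt r C"
    define T where "T = {b \<in> B. (m, b) \<in> r \<and> b \<noteq> m}"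
    have mX: "m \<in> B \<union> EP E indep r B" and CY: "C - {m} \<subseteq> B \<union> EA E indep r B"
      using sub unfolding circuit_nonface_subset_iff m_def basis_face_def by auto
    have mC: "m \<in> C" and m_le: "\<And>c. c \<in> C \<Longrightarrow> (m, c) \<in> r"
      using least_elt_circuit[OF C] unfolding m_def by auto
    have T: "indep T" "m \<notin> T"
      using BE(2) indep_hereditary[of B T] unfolding T_def by auto
    have "\<not> indep (insert m T)"
    proof (rule dependent_transfer[OF _ _ T])
      show "indep (C - {m})" using C mC unfolding circuit_def by blast
      show "\<not> indep (insert m (C - {m}))"
        using C mC unfolding circuit_def by (simp add: insert_absorb)
    next
      fix e assume e: "e \<in> C - {m} - T"
      then have "e \<notin> B" using m_le unfolding T_def by blast
      then have dep: "\<not> indep (insert e {b \<in> B. (e, b) \<in> r})"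
        using e CY mem_EA_iff[OF B] by blast
      have "{b \<in> B. (e, b) \<in> r} \<subseteq> T"
        using e m_le r_trans r_antisym unfolding T_def by blast
      then show "\<not> indep (insert e T)" using dep indep_hereditary by (meson insert_mono)
    qed
    moreover have "insert m T \<subseteq> insert m {b \<in> B. (m, b) \<in> r}" unfolding T_def by blast
    ultimately have dep: "\<not> indep (insert m {b \<in> B. (m, b) \<in> r})"
      using indep_hereditary by blast
    show False
    proof (cases "m \<in> B")
      case True
      then show False using dep BE(2) indep_hereditary[of B] by auto
    next
      case False
      then show False using mX dep mem_EA_iff[OF B] mem_EP_iff by blast
    qed
  qed
  moreover have "basis_face B \<subseteq> xy_set E E"
    using BE(1) unfolding basis_face_def EA_def EP_def by auto
  ultimately show ?thesis unfolding activity_complex_def by blast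
qed

lemma face_subset_basis_face:
  assumes F: "F \<in> activity_complex"
  obtains B where "basis E indep B" "F \<subseteq> basis_face B"
proof -
  define Y where "Y = {e. Inr e \<in> F}"
  \<comment> \<open>Increasing \<open>g\<close> runs through \<open>Y\<close> downwards and then through \<open>E - Y\<close> upwards; ranks are
    positive, so \<open>g\<close> is negative exactly on \<open>Y\<close>.\<close>
  define g where "g e = (if e \<in> Y then - int (rank e) else int (rank e))" for e
  have "inj_on g E"
    using inj_onD[OF rank_inj] rank_pos
    by (intro inj_onI) (fastforce simp: g_def split: if_splits)
  then obtain B where B: "basis E indep B"
    and greedy: "\<And>e. e \<in> E - B \<Longrightarrow> \<not> indep (insert e {b \<in> B. g b < g e})"
    by (rule greedy_basis) blast
  have BE: "B \<subseteq> E" using B unfolding basis_def by blast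
  have active: "e \<in> EA E indep r B" if e: "e \<in> Y" "e \<in> E - B" for e
  proof -
    have "{b \<in> B. g b < g e} \<subseteq> {b \<in> B. (e, b) \<in> r}"
      using e BE by (auto simp: g_def rank_le_iff[symmetric] subset_iff split: if_splits)
    then show ?thesis
      using greedy[OF e(2)] mem_EA_iff[OF B] e(2) indep_hereditary by (meson insert_mono)
  qed
  have not_active: "e \<notin> EA E indep r B" if e: "Inl e \<in> F" "e \<in> E - B" for e
  proof
    assume act: "e \<in> EA E indep r B"
    let ?C = "fundamental_circuit E indep B e"
    have "{b \<in> B. (e, b) \<in> r} \<subseteq> B" "{b \<in> B. g b < g e} \<subseteq> B" by auto
    note C = fundamental_circuit_subset[OF B e(2) this(1)]
      fundamental_circuit_subset(3)[OF B e(2) this(2) greedy[OF e(2)]]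
    have dep: "\<not> indep (insert e {b \<in> B. (e, b) \<in> r})" using act mem_EA_iff[OF B] by blast
    have least: "least_elt r ?C = e" using act unfolding EA_def by simp
    \<comment> \<open>An element above \<open>e\<close> can precede \<open>e\<close> in the greedy order only by lying in \<open>Y\<close>.\<close>
    have "b \<in> Y" if "b \<in> B" "(e, b) \<in> r" "g b < g e" for b
      using that BE e(2) rank_le_iff[of e b] by (auto simp: g_def split: if_splits)
    then have "?C - {e} \<subseteq> Y" using C(3)[OF dep] C(4) by blast
    then have "circuit_nonface ?C \<subseteq> F"
      using e(1) unfolding circuit_nonface_subset_iff least Y_def by auto
    then show False using F C(1)[OF dep] unfolding activity_complex_def by blast
  qed
  have "F \<subseteq> basis_face B"
  proof
    fix v assume v: "v \<in> F"
    have V: "F \<subseteq> xy_set E E" using F unfolding activity_complex_def by blast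
    show "v \<in> basis_face B"
    proof (cases v)
      case (Inl e)
      then have "e \<in> E" using v V by auto
      then show ?thesis using Inl v not_active[of e] mem_EP_iff[of e B]
        unfolding basis_face_def by auto
    next
      case (Inr e)
      then have "e \<in> E" using v V by auto
      then show ?thesis using Inr v active[of e] unfolding basis_face_def Y_def by auto
    qed
  qed
  then show ?thesis using that B by blast
qed

lemma basis_face_antichain:
  assumes "basis E indep B" "basis E indep B'" "basis_face B \<subseteq> basis_face B'"
  shows "B = B'"
proof (rule basis_subset_eq[OF assms(1,2)])
  have recover: "A = {e. Inl e \<in> basis_face A \<and> Inr e \<in> basis_face A}" for A
    unfolding basis_face_def EA_def EP_def by auto
  show "B \<subseteq> B'"
    using assms(3) recover[of B] recover[of B'] by blast
qed

lemma facets_activity_complex: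
  "facets activity_complex = {basis_face B | B. basis E indep B}"
proof (intro set_eqI iffI)
  fix F assume "F \<in> facets activity_complex"
  then have F: "F \<in> activity_complex" "\<And>G. G \<in> activity_complex \<Longrightarrow> F \<subseteq> G \<Longrightarrow> F = G"
    unfolding facets_def by auto
  obtain B where "basis E indep B" "F \<subseteq> basis_face B"
    using face_subset_basis_face[OF F(1)] by blast
  then show "F \<in> {basis_face B | B. basis E indep B}"
    using F(2)[OF basis_face_mem] by blast
next
  fix F assume "F \<in> {basis_face B | B. basis E indep B}"
  then obtain B where B: "basis E indep B" "F = basis_face B" by blast
  have "F = G" if G: "G \<in> activity_complex" "F \<subseteq> G" for G
  proof -
    obtain B' where B': "basis E indep B'" "G \<subseteq> basis_face B'"
      using face_subset_basis_face[OF G(1)] by blast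
    then have "B = B'" using basis_face_antichain[OF B(1) B'(1)] B(2) G(2) by blast
    then show ?thesis using B(2) B'(2) G(2) by blast
  qed
  then show "F \<in> facets activity_complex"
    using basis_face_mem[OF B(1)] B(2) unfolding facets_def by blast
qed

end

theorem theorem1p9:
  fixes E :: "'a set" and indep :: "'a set \<Rightarrow> bool" and r :: "'a rel"
  assumes "matroid E indep"
    and "linear_order_on E r"
  shows "\<exists>\<Delta> :: ('a + 'a) set set.
    simplicial_complex (xy_set E E) \<Delta> \<and>
    minimal_nonfaces (xy_set E E) \<Delta> =
      {xy_set {least_elt r C} (C - {least_elt r C}) | C. circuit E indep C} \<and>
    facets \<Delta> =
      {xy_set (B \<union> EP E indep r B) (B \<union> EA E indep r B) | B. basis E indep B}"
proof -
  interpret ordered_matroid E indep r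
    using assms by (simp add: ordered_matroid_def ordered_matroid_axioms_def)
  show ?thesis
    using simplicial_activity_complex minimal_nonfaces_activity_complex facets_activity_complex
    unfolding circuit_nonface_def basis_face_def by blast
qed

end
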